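(* Given $z_1^n\in(0,1)$ and $\Delta t_{\mathrm{im}}>0$, the updated volume fraction $z_1^{n+1}$ defined by the implicit (backward Euler) scheme $$\frac{z_1^{n+1}-z_1^n}{\Delta t_{\mathrm{im}}}=\kappa^{n+1}\,\nabla\cdot\mathbf u^n=:f(z_1^{n+1}),$$ where $\kappa^{n+1}=\kappa(z_1^{n+1})$ with $\kappa$ the function of the volume fraction defined in the context, admits a solution such that $z_1^{n+1}\in(0,1)$.
   Context: This is the backward Euler discretization of the $\kappa$-source term substep $\partial_t z_1=\kappa\nabla\cdot\mathbf u$ in an operator splitting of Kapila's five-equation two-phase model with the Tammann equation of state. In this substep the partial densities, momentum and total energy remain unchanged, so the mixture internal energy $(\rho e)^n$ and the velocity divergence $\nabla\cdot\mathbf u^n$ are given, and only the volume fraction $z_1$ of phase 1 is updated (in practice the scalar equation is solved at every quadrature point). Here $\Delta t_{\mathrm{im}}$ is the time step of the substep. The constants $\gamma_k$ and $p_{w,k}$ ($k=1,2$) are the specific heat ratio and the reference pressure of phase $k$. For a value $z$ of $z_1$ (with $z_2=1-z$), the mixture parameters $\gamma(z)$, $p_w(z)$ are defined by $$\frac{1}{\gamma(z)-1}=\frac{z}{\gamma_1-1}+\frac{1-z}{\gamma_2-1},\qquad \frac{\gamma(z)p_w(z)}{\gamma(z)-1}=\frac{z\,\gamma_1p_{w,1}}{\gamma_1-1}+\frac{(1-z)\,\gamma_2p_{w,2}}{\gamma_2-1},$$ and $$p(z)=(\rho e)^n(\gamma(z)-1)-\gamma(z)p_w(z),\qquad \nu_k(z)=\frac{1}{\gamma_k\,(p(z)+p_{w,k})}\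 (k=1,2),$$ $$\nu(z)=z\,\nu_1(z)+(1-z)\,\nu_2(z),\qquad \kappa(z)=z(1-z)\,\frac{\nu_1(z)-\nu_2(z)}{\nu(z)}.$$
   Formalization: The formal theorem assumes γ_k>1 and that p(z)+p_{w,1}, p(z)+p_{w,2} and ν(z) are nonzero for every z in the closed interval [0,1]; without this κ can be singular or fail to vanish at an endpoint, and the scheme may have no solution in (0,1). *)

theory Defs
  imports Complex_Main
begin

text \<open>
  Parameters: \<open>g1\<close>, \<open>w1\<close>, \<open>g2\<close>, \<open>w2\<close> are the specific heat ratios and reference pressures of the
  two phases, \<open>E\<close> is the given mixture internal energy per unit volume, and \<open>z\<close> is the volume
  fraction of phase 1.
  The mixture parameters are given implicitly, by the values of 1/(gamma - 1) and
  gamma p_w/(gamma - 1); the definitions below are those relations solved for gamma and p_w,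
  and the lemmas \<open>gamma_mix_relation\<close> and \<open>pw_mix_relation\<close> recover the relations.
  Since x / 0 = 0 in HOL, \<open>kappa\<close> has its intended meaning only where \<open>pressure + w1\<close>,
  \<open>pressure + w2\<close> and \<open>nu\<close> are nonzero.
\<close>

definition gamma_mix :: "real \<Rightarrow> real \<Rightarrow> real \<Rightarrow> real" where
  "gamma_mix g1 g2 z = 1 + 1 / (z / (g1 - 1) + (1 - z) / (g2 - 1))"

definition pw_mix :: "real \<Rightarrow> real \<Rightarrow> real \<Rightarrow> real \<Rightarrow> real \<Rightarrow> real" where
  "pw_mix g1 w1 g2 w2 z =
     (gamma_mix g1 g2 z - 1) / gamma_mix g1 g2 z
       * (z * g1 * w1 / (g1 - 1) + (1 - z) * g2 * w2 / (g2 - 1))"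

definition pressure :: "real \<Rightarrow> real \<Rightarrow> real \<Rightarrow> real \<Rightarrow> real \<Rightarrow> real \<Rightarrow> real" where
  "pressure g1 w1 g2 w2 E z =
     E * (gamma_mix g1 g2 z - 1) - gamma_mix g1 g2 z * pw_mix g1 w1 g2 w2 z"

definition nu1 :: "real \<Rightarrow> real \<Rightarrow> real \<Rightarrow> real \<Rightarrow> real \<Rightarrow> real \<Rightarrow> real" where
  "nu1 g1 w1 g2 w2 E z = 1 / (g1 * (pressure g1 w1 g2 w2 E z + w1))"

definition nu2 :: "real \<Rightarrow> real \<Rightarrow> real \<Rightarrow> real \<Rightarrow> real \<Rightarrow> real \<Rightarrow> real" where
  "nu2 g1 w1 g2 w2 E z = 1 / (g2 * (pressure g1 w1 g2 w2 E z + w2))"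

definition nu :: "real \<Rightarrow> real \<Rightarrow> real \<Rightarrow> real \<Rightarrow> real \<Rightarrow> real \<Rightarrow> real" where
  "nu g1 w1 g2 w2 E z = z * nu1 g1 w1 g2 w2 E z + (1 - z) * nu2 g1 w1 g2 w2 E z"

definition kappa :: "real \<Rightarrow> real \<Rightarrow> real \<Rightarrow> real \<Rightarrow> real \<Rightarrow> real \<Rightarrow> real" where
  "kappa g1 w1 g2 w2 E z =
     z * (1 - z) * ((nu1 g1 w1 g2 w2 E z - nu2 g1 w1 g2 w2 E z) / nu g1 w1 g2 w2 E z)"

lemma gamma_mix_relation:
  "1 / (gamma_mix g1 g2 z - 1) = z / (g1 - 1) + (1 - z) / (g2 - 1)"
  by (simp add: gamma_mix_def)

lemma gamma_mix_gt_1: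
  assumes "g1 > 1" "g2 > 1" "z \<in> {0..1}"
  shows "gamma_mix g1 g2 z > 1"
proof -
  have "z / (g1 - 1) + (1 - z) / (g2 - 1) > 0"
  proof (cases "z = 0")
    case False
    then show ?thesis using assms by (intro add_pos_nonneg) auto
  qed (use assms in auto)
  then show ?thesis by (simp add: gamma_mix_def)
qed

lemma pw_mix_relation:
  assumes "g1 > 1" "g2 > 1" "z \<in> {0..1}"
  shows "gamma_mix g1 g2 z * pw_mix g1 w1 g2 w2 z / (gamma_mix g1 g2 z - 1)
       = z * g1 * w1 / (g1 - 1) + (1 - z) * g2 * w2 / (g2 - 1)"
  using gamma_mix_gt_1[OF assms] by (simp add: pw_mix_def)

end

theory Submission
  imports Defs
begin

text \<open>
  The residual of the scheme is continuous in the volume fraction on [0, 1], and since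
  \<open>kappa\<close> vanishes at both ends, it is negative at 0 and positive at 1; conclude by the
  intermediate value theorem.
\<close>

lemma continuous_on_gamma_mix [continuous_intros]:
  assumes "g1 > 1" "g2 > 1"
  shows "continuous_on {0..1} (gamma_mix g1 g2)"
proof -
  \<comment> \<open>If this sum were 0, the convention 1 / 0 = 0 would make \<open>gamma_mix\<close>
    equal to 1, contradicting \<open>gamma_mix_gt_1\<close>.\<close>
  have "z / (g1 - 1) + (1 - z) / (g2 - 1) \<noteq> 0" if "z \<in> {0..1}" for z
    using gamma_mix_gt_1[OF assms that] by (auto simp: gamma_mix_def)
  then show ?thesis
    unfolding gamma_mix_def using assms by (intro continuous_intros) auto
qed

lemma continuous_on_pressure [continuous_intros]:
  assumes "g1 > 1" "g2 > 1"
  shows "continuous_on {0..1} (pressure g1 w1 g2 w2 E)"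
proof -
  \<comment> \<open>\<open>pw_mix\<close> divides by \<open>gamma_mix\<close>.\<close>
  have "gamma_mix g1 g2 z \<noteq> 0" if "z \<in> {0..1}" for z
    using gamma_mix_gt_1[OF assms that] by auto
  then show ?thesis
    unfolding pressure_def pw_mix_def using assms by (intro continuous_intros) auto
qed

text \<open>The assumptions keep the denominators of \<open>nu1\<close>, \<open>nu2\<close> and
  \<open>kappa\<close> nonzero up to the endpoints, so the convention x / 0 = 0 cannot cause a
  jump.\<close>

lemma continuous_on_kappa:
  assumes "g1 > 1" "g2 > 1"
    and "\<And>z. z \<in> {0..1} \<Longrightarrow> pressure g1 w1 g2 w2 E z + w1 \<noteq> 0"
    and "\<And>z. z \<in> {0..1} \<Longrightarrow> pressure g1 w1 g2 w2 E z + w2 \<noteq> 0"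
    and "\<And>z. z \<in> {0..1} \<Longrightarrow> nu g1 w1 g2 w2 E z \<noteq> 0"
  shows "continuous_on {0..1} (kappa g1 w1 g2 w2 E)"
proof -
  have 1: "continuous_on {0..1} (nu1 g1 w1 g2 w2 E)"
    unfolding nu1_def using assms by (intro continuous_intros) auto
  have 2: "continuous_on {0..1} (nu2 g1 w1 g2 w2 E)"
    unfolding nu2_def using assms by (intro continuous_intros) auto
  have "continuous_on {0..1} (nu g1 w1 g2 w2 E)"
    unfolding nu_def by (intro continuous_intros 1 2)
  with 1 2 show ?thesis
    unfolding kappa_def using assms(5) by (intro continuous_intros) auto
qed

theorem theorem3p1:
  fixes g1 w1 g2 w2 E divu zn dt :: real
  assumes "g1 > 1" and "g2 > 1"
    and "\<And>z. z \<in> {0..1} \<Longrightarrow> pressure g1 w1 g2 w2 E z + w1 \<noteq> 0"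
    and "\<And>z. z \<in> {0..1} \<Longrightarrow> pressure g1 w1 g2 w2 E z + w2 \<noteq> 0"
    and "\<And>z. z \<in> {0..1} \<Longrightarrow> nu g1 w1 g2 w2 E z \<noteq> 0"
    and "zn \<in> {0<..<1}" and "dt > 0"
  shows "\<exists>z \<in> {0<..<1}. (z - zn) / dt = kappa g1 w1 g2 w2 E z * divu"
proof -
  define F where "F z = (z - zn) / dt - kappa g1 w1 g2 w2 E z * divu" for z
  \<comment> \<open>The factor \<open>z * (1 - z)\<close> leaves -\<open>zn\<close> /
    \<open>dt\<close> at 0 and (1 - \<open>zn\<close>) / \<open>dt\<close> at 1, whatever the sign
    of \<open>divu\<close>.\<close>
  have F0: "F 0 < 0" and F1: "F 1 > 0"
    using assms(6,7) by (simp_all add: F_def kappa_def)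
  have "continuous_on {0..1} F"
    unfolding F_def using assms(7)
    by (intro continuous_intros continuous_on_kappa assms(1-5)) auto
  then obtain z where z: "0 \<le> z" "z \<le> 1" "F z = 0"
    using IVT'[of F 0 0 1] F0 F1 by auto
  \<comment> \<open>The strict signs at the ends move the root from the closed interval into the
    open one.\<close>
  with F0 F1 have "z \<noteq> 0" "z \<noteq> 1"
    by auto
  with z show ?thesis
    by (intro bexI[of _ z]) (auto simp: F_def)
qed

end
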